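(* Let $n$ and $m$ be two distinct natural numbers, each at least $2$. 1. If $nm$ is even, then $D_\mathcal{G}(K_n\square K_m)=\infty$; if $nm$ is odd, then $D_\mathcal{R}(K_n\square K_m)=\infty$. 2. If $n$ is even, $m\neq n$ and $m\geq n-1$, then $D_\mathcal{R}(K_n\square K_m)\leq m+1$. 3. If $n$ is odd, $m$ is even and $m\geq 2n-2$, then $D_\mathcal{R}(K_n\square K_m)\leq m+1$. 4. If $n$ and $m$ are odd and $m\geq 2n-1$, then $D_\mathcal{G}(K_n\square K_m)\leq m+1$.
   Context: $K_n$ is the complete graph of order $n$ and $\square$ the Cartesian product. A coloring of a graph $X$ is distinguishing if the identity is its only color-preserving automorphism. The distinguishing game on $X$ with $d$ colors: Gentle and Rascal alternately choose an uncolored vertex and color it with one of the $d$ colors; when all vertices are colored, Gentle wins iff the coloring is distinguishing. $D_\mathcal{G}(X)$ (resp. $D_\mathcal{R}(X)$) is the least $d$ such that Gentle has a winning strategy with $d$ colors when Gentle (resp. Rascal) moves first, and $\infty$ if no such $d$ exists. *)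

theory Defs
  imports "Graph_Theory.Graph_Theory" "HOL-Library.Extended_Nat"
begin

text \<open>
  A finite simple graph is a \<^term>\<open>pair_graph\<close> of the AFP entry Graph Theory: an undirected edge is
  represented by its two orientations.
\<close>

definition complete_graph :: "nat \<Rightarrow> nat pair_pre_digraph" where
  "complete_graph n = \<lparr>pverts = {..<n}, parcs = {(u, v). u < n \<and> v < n \<and> u \<noteq> v}\<rparr>"

definition cartesian_product ::
  "'a pair_pre_digraph \<Rightarrow> 'b pair_pre_digraph \<Rightarrow> ('a \<times> 'b) pair_pre_digraph" (infixl \<open>\<box>\<close> 70) where
  "G \<box> H = \<lparr>pverts = pverts G \<times> pverts H,
            parcs = {((u, v), (u', v')).
                       (u = u' \<and> u \<in> pverts G \<and> (v, v') \<in> parcs H) \<or>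
                       (v = v' \<and> v \<in> pverts H \<and> (u, u') \<in> parcs G)}\<rparr>"

lemma pair_graph_complete_graph: "pair_graph (complete_graph n)"
  by unfold_locales
     (auto simp: complete_graph_def arc_to_ends_def symmetric_def sym_def
           intro: finite_subset[of _ "{..<n} \<times> {..<n}"])

lemma complete_digraph_complete_graph: "complete_digraph n (with_proj (complete_graph n))"
proof -
  interpret pair_graph "complete_graph n" by (rule pair_graph_complete_graph)
  show ?thesis
    unfolding complete_digraph_def
    by (intro conjI) (unfold_locales, auto simp: complete_graph_def arcs_ends_def arc_to_ends_def)
qed

lemma pair_graph_cartesian_product:
  assumes "pair_graph G" "pair_graph H"
  shows "pair_graph (G \<box> H)"
proof -
  interpret G: pair_graph G by fact
  interpret H: pair_graph H by fact
  have "parcs (G \<box> H) \<subseteq> (pverts G \<times> pverts H) \<times> (pverts G \<times> pverts H)"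
    by (auto simp: cartesian_product_def G.in_arcsD1 G.in_arcsD2 H.in_arcsD1 H.in_arcsD2)
  then have "finite (parcs (G \<box> H))"
    by (rule finite_subset) (intro finite_cartesian_product G.pair_finite_verts H.pair_finite_verts)
  then show ?thesis
    by unfold_locales
       (auto simp: cartesian_product_def arc_to_ends_def symmetric_def sym_def
             dest: G.in_arcsD1 G.in_arcsD2 H.in_arcsD1 H.in_arcsD2 G.pair_no_loops H.pair_no_loops
                   G.arcs_symmetric H.arcs_symmetric)
qed

definition automorphism :: "'a pair_pre_digraph \<Rightarrow> ('a \<Rightarrow> 'a) \<Rightarrow> bool" where
  "automorphism G f \<longleftrightarrow>
     bij_betw f (pverts G) (pverts G) \<and>
     (\<forall>u\<in>pverts G. \<forall>v\<in>pverts G. (f u, f v) \<in> parcs G \<longleftrightarrow> (u, v) \<in> parcs G)"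

definition distinguishing :: "'a pair_pre_digraph \<Rightarrow> ('a \<Rightarrow> 'c) \<Rightarrow> bool" where
  "distinguishing G c \<longleftrightarrow>
     (\<forall>f. automorphism G f \<and> (\<forall>v\<in>pverts G. c (f v) = c v) \<longrightarrow> (\<forall>v\<in>pverts G. f v = v))"

text \<open>
  A play is the chronological list of the moves made so far; the move \<^term>\<open>(v, i)\<close> gives vertex
  \<^term>\<open>v\<close> the color \<^term>\<open>i\<close>. The colors are \<^term>\<open>{..<d::nat}\<close>.
\<close>

datatype player = Gentle | Rascal

type_synonym 'a move = "'a \<times> nat"
type_synonym 'a play = "'a move list"
type_synonym 'a strategy = "'a play \<Rightarrow> 'a move"

fun opponent :: "player \<Rightarrow> player" where
  "opponent Gentle = Rascal"
| "opponent Rascal = Gentle"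

definition to_move :: "player \<Rightarrow> 'a play \<Rightarrow> player" where
  "to_move first p = (if even (length p) then first else opponent first)"

definition colored :: "'a play \<Rightarrow> 'a set" where
  "colored p = fst ` set p"

definition legal_move :: "'a pair_pre_digraph \<Rightarrow> nat \<Rightarrow> 'a play \<Rightarrow> 'a move \<Rightarrow> bool" where
  "legal_move G d p mv \<longleftrightarrow> fst mv \<in> pverts G \<and> fst mv \<notin> colored p \<and> snd mv < d"

definition legal_play :: "'a pair_pre_digraph \<Rightarrow> nat \<Rightarrow> 'a play \<Rightarrow> bool" where
  "legal_play G d p \<longleftrightarrow> (\<forall>i<length p. legal_move G d (take i p) (p ! i))"

definition finished :: "'a pair_pre_digraph \<Rightarrow> 'a play \<Rightarrow> bool" where
  "finished G p \<longleftrightarrow> colored p = pverts G"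

definition final_coloring :: "'a play \<Rightarrow> 'a \<Rightarrow> nat" where
  "final_coloring p v = the (map_of p v)"

definition follows_gentle :: "player \<Rightarrow> 'a strategy \<Rightarrow> 'a play \<Rightarrow> bool" where
  "follows_gentle first s p \<longleftrightarrow>
     (\<forall>i<length p. to_move first (take i p) = Gentle \<longrightarrow> p ! i = s (take i p))"

definition winning_strategy_gentle ::
  "'a pair_pre_digraph \<Rightarrow> nat \<Rightarrow> player \<Rightarrow> 'a strategy \<Rightarrow> bool" where
  "winning_strategy_gentle G d first s \<longleftrightarrow>
     (\<forall>p. legal_play G d p \<and> follows_gentle first s p \<longrightarrow>
        (\<not> finished G p \<and> to_move first p = Gentle \<longrightarrow> legal_move G d p (s p)) \<and>
        (finished G p \<longrightarrow> distinguishing G (final_coloring p)))"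

text \<open>
  The number of colors is required to be positive: with no colors and Rascal moving first, Rascal
  has no legal move on a nonempty graph, no play is ever finished, and every strategy of Gentle
  would win vacuously. If no number of colors suffices, the infimum is \<^term>\<open>Inf {} = (\<infinity>::enat)\<close>.
\<close>

definition distinguishing_game_number :: "player \<Rightarrow> 'a pair_pre_digraph \<Rightarrow> enat" where
  "distinguishing_game_number first G =
     Inf {enat d | d. 0 < d \<and> (\<exists>s. winning_strategy_gentle G d first s)}"

abbreviation D_G :: "'a pair_pre_digraph \<Rightarrow> enat" where
  "D_G \<equiv> distinguishing_game_number Gentle"

abbreviation D_R :: "'a pair_pre_digraph \<Rightarrow> enat" where
  "D_R \<equiv> distinguishing_game_number Rascal"

end

theory Submission
  imports Defs "HOL-Number_Theory.Cong"
begin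

text \<open>
  Rascal wins by mirroring in the center of the grid, after occupying the center if there is one.

  Gentle answers inside the column of Rascal's last move, in the row matched with his, using a
  color that differs from his and makes the sums of the full columns distinct modulo \<open>m + 1\<close>.
  Since \<open>n \<noteq> m\<close>, an automorphism permutes rows and columns; the sums fix every column, and if every
  pair of rows is matched in some column, then every row is fixed too. For even \<open>n\<close> the matchings of
  the columns form a one-factorization of the complete graph on the rows, which needs \<open>n - 1\<close>
  columns. For odd \<open>n\<close> the first move in a column determines the row that is left unmatched; when
  Rascal makes a first move in a column, Gentle answers with a first move in another column, at a
  row that has not been left unmatched before. So Gentle makes the last move in every column, and
  all the \<open>n\<close> near-perfect matchings given by reflections modulo \<open>n\<close> occur.
\<close>

section \<open>Plays\<close>

lemma legal_play_Nil [simp]: "legal_play G d []"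
  by (simp add: legal_play_def)

lemma legal_play_snoc [simp]:
  "legal_play G d (p @ [mv]) \<longleftrightarrow> legal_play G d p \<and> legal_move G d p mv"
  by (auto simp: legal_play_def nth_append less_Suc_eq)

lemma follows_gentle_Nil [simp]: "follows_gentle first s []"
  by (simp add: follows_gentle_def)

lemma follows_gentle_snoc [simp]:
  "follows_gentle first s (p @ [mv]) \<longleftrightarrow>
     follows_gentle first s p \<and> (to_move first p = Gentle \<longrightarrow> mv = s p)"
  by (auto simp: follows_gentle_def nth_append less_Suc_eq)

lemma to_move_snoc [simp]: "to_move first (p @ [mv]) = opponent (to_move first p)"
  by (cases first) (auto simp: to_move_def)

lemma to_move_Nil [simp]: "to_move first [] = first"
  by (simp add: to_move_def)

lemma colored_eq_dom: "colored p = dom (map_of p)"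
  by (simp add: colored_def dom_map_of_conv_image_fst)

text \<open>\<open>map_of\<close> returns the earliest entry for a key, so an appended move acts as
  a map update only at a vertex that has no color yet.\<close>

lemma map_of_snoc:
  assumes "fst mv \<notin> colored p"
  shows "map_of (p @ [mv]) = (map_of p)(fst mv \<mapsto> snd mv)"
proof
  fix v
  have "map_of p (fst mv) = None"
    using assms by (simp add: colored_eq_dom domIff)
  then show "map_of (p @ [mv]) v = ((map_of p)(fst mv \<mapsto> snd mv)) v"
    by (cases mv) (auto simp: map_add_def split: option.splits)
qed

text \<open>Reduces the game to an invariant of the partial coloring, forgetting the order of the
  moves. \<open>J\<close> describes the positions with Rascal to move, and the strategy picks any
  legal move that restores \<open>J\<close>.\<close>

lemma winning_strategy_from_invariant:
  fixes J :: "('a \<rightharpoonup> nat) \<Rightarrow> bool"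
  assumes start: "if first = Rascal then J Map.empty
      else \<exists>w\<in>pverts G. \<exists>k<d. J [w \<mapsto> k]"
    and reply: "\<And>c v i. \<lbrakk>J c; v \<in> pverts G; c v = None; i < d\<rbrakk> \<Longrightarrow>
      \<exists>w\<in>pverts G. \<exists>k<d. (c(v \<mapsto> i)) w = None \<and> J (c(v \<mapsto> i, w \<mapsto> k))"
    and final: "\<And>c. \<lbrakk>J c; pverts G \<subseteq> dom c\<rbrakk> \<Longrightarrow> distinguishing G (\<lambda>v. the (c v))"
  shows "\<exists>s. winning_strategy_gentle G d first s"
proof -
  define good where "good p mv \<longleftrightarrow> legal_move G d p mv \<and> J (map_of (p @ [mv]))" for p mv
  define s where "s p = (SOME mv. good p mv)" for p
  have s: "good p (s p)" if "\<exists>mv. good p mv" for p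
    using that unfolding s_def by (rule someI_ex)
  \<comment> \<open>With Gentle to move, \<open>J\<close> is replaced by the existence of a move
    that restores it, which is what the choice of \<open>s\<close> needs.\<close>
  have inv: "if to_move first p = Rascal then J (map_of p) else \<exists>mv. good p mv"
    if "legal_play G d p" "follows_gentle first s p" for p
    using that
  proof (induction p rule: rev_induct)
    case Nil
    show ?case
    proof (cases "first = Rascal")
      case True
      then show ?thesis using start by simp
    next
      case False
      with start obtain w k where "w \<in> pverts G" "k < d" "J [w \<mapsto> k]" by auto
      then have "good [] (w, k)"
        by (simp add: good_def legal_move_def colored_def)
      then show ?thesis using False by auto
    qed
  next
    case (snoc mv p)
    show ?case
    proof (cases "to_move first p = Rascal")
      case True
      then have J: "J (map_of p)" using snoc by simp
      have mv: "fst mv \<in> pverts G" "fst mv \<notin> colored p" "snd mv < d"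
        using snoc.prems by (auto simp: legal_move_def)
      from mv(2) have "map_of p (fst mv) = None" by (simp add: colored_eq_dom domIff)
      from reply[OF J mv(1) this mv(3)] obtain w k where
        w: "w \<in> pverts G" "k < d" "((map_of p)(fst mv \<mapsto> snd mv)) w = None"
          "J ((map_of p)(fst mv \<mapsto> snd mv, w \<mapsto> k))" by blast
      have eq: "map_of (p @ [mv]) = (map_of p)(fst mv \<mapsto> snd mv)"
        using mv(2) by (rule map_of_snoc)
      have fresh: "w \<notin> colored (p @ [mv])"
        unfolding colored_eq_dom eq using w(3) by (simp only: domIff) simp
      have "map_of ((p @ [mv]) @ [(w, k)]) = (map_of p)(fst mv \<mapsto> snd mv, w \<mapsto> k)"
        using map_of_snoc[of "(w, k)" "p @ [mv]"] fresh unfolding eq fst_conv snd_conv by blast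
      then have "good (p @ [mv]) (w, k)"
        unfolding good_def legal_move_def using w fresh by (simp only: fst_conv snd_conv) simp
      then show ?thesis using True by auto
    next
      case False
      then have "to_move first p = Gentle" by (cases "to_move first p") auto
      moreover from this snoc have "\<exists>mv. good p mv" by auto
      ultimately show ?thesis using s[of p] snoc.prems by (auto simp: good_def)
    qed
  qed
  have "winning_strategy_gentle G d first s"
    unfolding winning_strategy_gentle_def
  proof (intro allI impI conjI; elim conjE)
    fix p assume p: "legal_play G d p" "follows_gentle first s p" "to_move first p = Gentle"
    then show "legal_move G d p (s p)" using inv[OF p(1,2)] s[of p] by (auto simp: good_def)
  next
    fix p assume p: "legal_play G d p" "follows_gentle first s p" "finished G p"
    \<comment> \<open>With Gentle to move, the invariant would supply an uncolored vertex, which a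
      finished play does not have.\<close>
    have "to_move first p = Rascal"
    proof (rule ccontr)
      assume "to_move first p \<noteq> Rascal"
      then obtain mv where "good p mv" using inv[OF p(1,2)] by auto
      then show False using p(3) by (auto simp: good_def legal_move_def finished_def)
    qed
    then have "J (map_of p)" using inv[OF p(1,2)] by simp
    moreover have "pverts G \<subseteq> dom (map_of p)"
      using p(3) by (simp add: finished_def colored_eq_dom)
    ultimately show "distinguishing G (final_coloring p)"
      using final by (simp add: final_coloring_def[abs_def])
  qed
  then show ?thesis by blast
qed

lemma game_number_le:
  assumes "0 < d" "\<exists>s. winning_strategy_gentle G d first s"
  shows "distinguishing_game_number first G \<le> enat d"
  unfolding distinguishing_game_number_def using assms by (intro Inf_lower) auto

text \<open>Rascal repeats each color at the image under \<phi>. By symmetry the image of an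
  uncolored vertex is uncolored, and it is a different vertex because all fixed points are colored
  already. The induction is on the number of uncolored vertices.\<close>

lemma mirror_play:
  fixes \<phi> :: "'a \<Rightarrow> 'a" and p :: "'a play"
  assumes fin: "finite (pverts G)"
    and win: "winning_strategy_gentle G d first s"
    and into: "\<And>v. v \<in> pverts G \<Longrightarrow> \<phi> v \<in> pverts G"
    and invol: "\<And>v. v \<in> pverts G \<Longrightarrow> \<phi> (\<phi> v) = v"
    and p: "legal_play G d p" "follows_gentle first s p" "to_move first p = Gentle"
    and sym: "\<And>v. v \<in> pverts G \<Longrightarrow> map_of p (\<phi> v) = map_of p v"
    and fixed: "\<And>v. \<lbrakk>v \<in> pverts G; \<phi> v = v\<rbrakk> \<Longrightarrow> v \<in> colored p"
  shows "\<exists>q. legal_play G d q \<and> follows_gentle first s q \<and> finished G q \<and>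
           (\<forall>v\<in>pverts G. map_of q (\<phi> v) = map_of q v)"
  using p sym fixed
proof (induction "card (pverts G - colored p)" arbitrary: p rule: less_induct)
  case less
  show ?case
  proof (cases "finished G p")
    case True
    with less.prems show ?thesis by blast
  next
    case False
    with win less.prems have mv: "legal_move G d p (s p)"
      unfolding winning_strategy_gentle_def by blast
    obtain v k where vk: "s p = (v, k)" by (cases "s p")
    have v: "v \<in> pverts G" "v \<notin> colored p" "k < d"
      using mv vk by (auto simp: legal_move_def)
    have ne: "\<phi> v \<noteq> v" using v less.prems(5) by blast
    have "map_of p v = None" using v(2) by (simp add: colored_eq_dom domIff)
    then have "map_of p (\<phi> v) = None" using less.prems(4) v(1) by simp
    then have \<phi>v: "\<phi> v \<notin> colored p" by (simp add: colored_eq_dom domIff)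
    define p1 where "p1 = p @ [(v, k)]"
    define q where "q = p1 @ [(\<phi> v, k)]"
    have col1: "colored p1 = insert v (colored p)" by (auto simp: p1_def colored_def)
    have colq: "colored q = insert (\<phi> v) (insert v (colored p))"
      by (auto simp: q_def p1_def colored_def)
    have mq: "map_of q = (map_of p)(v \<mapsto> k, \<phi> v \<mapsto> k)"
      using map_of_snoc[of "(v, k)" p] map_of_snoc[of "(\<phi> v, k)" p1] v \<phi>v ne col1
      by (simp add: q_def p1_def del: append_assoc)
    have tm: "to_move first p1 = Rascal" using less.prems(3) by (simp add: p1_def)
    show ?thesis
    proof (rule less.hyps[of q])
      have "pverts G - colored q \<subset> pverts G - colored p" using v colq by blast
      then show "card (pverts G - colored q) < card (pverts G - colored p)"
        using fin by (intro psubset_card_mono) auto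
      have "legal_play G d p1" using less.prems(1) mv vk by (simp add: p1_def)
      then show "legal_play G d q"
        using into[OF v(1)] \<phi>v ne v(3) col1 by (simp add: q_def legal_move_def)
      show "follows_gentle first s q"
        using less.prems(2) vk tm by (simp add: q_def p1_def del: append_assoc)
      show "to_move first q = Gentle" using tm by (simp add: q_def)
      show "map_of q (\<phi> u) = map_of q u" if "u \<in> pverts G" for u
        using less.prems(4)[OF that] invol[OF that] invol[OF v(1)] unfolding mq by auto
      show "u \<in> colored q" if "u \<in> pverts G" "\<phi> u = u" for u
        using less.prems(5)[OF that] colq by blast
    qed
  qed
qed

section \<open>Automorphisms of the product of two complete graphs\<close>

context
  fixes n m :: nat
begin

abbreviation (input) "KK \<equiv> complete_graph n \<box> complete_graph m"

lemma pverts_KK [simp]: "pverts KK = {..<n} \<times> {..<m}"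
  by (simp add: cartesian_product_def complete_graph_def)

lemma parcs_KK:
  "((i, j), (i', j')) \<in> parcs KK \<longleftrightarrow>
     i < n \<and> i' < n \<and> j < m \<and> j' < m \<and> (i = i' \<and> j \<noteq> j' \<or> j = j' \<and> i \<noteq> i')"
  by (auto simp: cartesian_product_def complete_graph_def)

definition common_neighbours :: "nat \<times> nat \<Rightarrow> nat \<times> nat \<Rightarrow> (nat \<times> nat) set" where
  "common_neighbours u v = {w \<in> pverts KK. (u, w) \<in> parcs KK \<and> (v, w) \<in> parcs KK}"

lemma card_common_neighbours_row:
  assumes "i < n" "j < m" "j' < m" "j \<noteq> j'"
  shows "card (common_neighbours (i, j) (i, j')) = m - 2"
proof -
  have "common_neighbours (i, j) (i, j') = {i} \<times> ({..<m} - {j, j'})"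
    using assms by (auto simp: common_neighbours_def parcs_KK)
  then show ?thesis using assms by (simp add: card_cartesian_product card_Diff_subset)
qed

lemma card_common_neighbours_column:
  assumes "i < n" "i' < n" "j < m" "i \<noteq> i'"
  shows "card (common_neighbours (i, j) (i', j)) = n - 2"
proof -
  have "common_neighbours (i, j) (i', j) = ({..<n} - {i, i'}) \<times> {j}"
    using assms by (auto simp: common_neighbours_def parcs_KK)
  then show ?thesis using assms by (simp add: card_cartesian_product card_Diff_subset)
qed

lemma card_common_neighbours_automorphism:
  assumes f: "automorphism KK f" and u: "u \<in> pverts KK" and v: "v \<in> pverts KK"
  shows "card (common_neighbours (f u) (f v)) = card (common_neighbours u v)"
proof -
  have bij: "bij_betw f (pverts KK) (pverts KK)"
    and arc: "\<And>x y. \<lbrakk>x \<in> pverts KK; y \<in> pverts KK\<rbrakk> \<Longrightarrow>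
      (f x, f y) \<in> parcs KK \<longleftrightarrow> (x, y) \<in> parcs KK"
    using f unfolding automorphism_def by blast+
  have "f ` common_neighbours u v = common_neighbours (f u) (f v)"
  proof (intro equalityI subsetI)
    fix w assume "w \<in> f ` common_neighbours u v"
    then show "w \<in> common_neighbours (f u) (f v)"
      using bij_betwE[OF bij] arc u v unfolding common_neighbours_def by blast
  next
    fix w assume w: "w \<in> common_neighbours (f u) (f v)"
    then have "w \<in> f ` pverts KK"
      using bij_betw_imp_surj_on[OF bij] by (simp add: common_neighbours_def)
    then obtain x where x: "w = f x" "x \<in> pverts KK" by blast
    then show "w \<in> f ` common_neighbours u v"
      using w arc u v unfolding common_neighbours_def by blast
  qed
  moreover have "inj_on f (common_neighbours u v)"
    using bij by (auto simp: bij_betw_def common_neighbours_def intro: inj_on_subset)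
  ultimately show ?thesis by (metis card_image)
qed

text \<open>Two vertices of a row have m - 2 common neighbours and two vertices of a column have n -
  2. As these numbers differ, an automorphism maps row edges to row edges and column edges to column
  edges. So the row of an image depends only on the row, and its column only on the column.\<close>

lemma automorphism_product_form:
  assumes nm: "n \<ge> 2" "m \<ge> 2" "n \<noteq> m" and f: "automorphism KK f"
  obtains \<sigma> \<tau> where "inj_on \<sigma> {..<n}" "\<sigma> ` {..<n} \<subseteq> {..<n}" "\<tau> ` {..<m} \<subseteq> {..<m}"
    "\<And>i j. \<lbrakk>i < n; j < m\<rbrakk> \<Longrightarrow> f (i, j) = (\<sigma> i, \<tau> j)"
proof -
  have bij: "bij_betw f (pverts KK) (pverts KK)"
    and arc: "\<And>x y. \<lbrakk>x \<in> pverts KK; y \<in> pverts KK\<rbrakk> \<Longrightarrow>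
      (f x, f y) \<in> parcs KK \<longleftrightarrow> (x, y) \<in> parcs KK"
    using f unfolding automorphism_def by blast+
  have row: "fst (f (i, j)) = fst (f (i, j'))" if "i < n" "j < m" "j' < m" for i j j'
  proof (cases "j = j'")
    case False
    obtain a b a' b' where ab: "f (i, j) = (a, b)" "f (i, j') = (a', b')" by fastforce
    have "((a, b), (a', b')) \<in> parcs KK"
      using arc[of "(i, j)" "(i, j')"] that False ab by (simp add: parcs_KK)
    moreover have "card (common_neighbours (a, b) (a', b')) = m - 2"
      using card_common_neighbours_automorphism[OF f, of "(i, j)" "(i, j')"] that False ab
        card_common_neighbours_row by simp
    ultimately have "a = a'"
      using card_common_neighbours_column[of a a' b] nm by (auto simp: parcs_KK)
    then show ?thesis using ab by simp
  qed simp
  have col: "snd (f (i, j)) = snd (f (i', j))" if "i < n" "i' < n" "j < m" for i i' j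
  proof (cases "i = i'")
    case False
    obtain a b a' b' where ab: "f (i, j) = (a, b)" "f (i', j) = (a', b')" by fastforce
    have "((a, b), (a', b')) \<in> parcs KK"
      using arc[of "(i, j)" "(i', j)"] that False ab by (simp add: parcs_KK)
    moreover have "card (common_neighbours (a, b) (a', b')) = n - 2"
      using card_common_neighbours_automorphism[OF f, of "(i, j)" "(i', j)"] that False ab
        card_common_neighbours_column by simp
    ultimately have "b = b'"
      using card_common_neighbours_row[of a b b'] nm by (auto simp: parcs_KK)
    then show ?thesis using ab by simp
  qed simp
  define \<sigma> where "\<sigma> i = fst (f (i, 0))" for i
  define \<tau> where "\<tau> j = snd (f (0, j))" for j
  have form: "f (i, j) = (\<sigma> i, \<tau> j)" if "i < n" "j < m" for i j
    using row[of i j 0] col[of i 0 j] that nm by (simp add: \<sigma>_def \<tau>_def prod_eq_iff)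
  have mem: "f (i, j) \<in> {..<n} \<times> {..<m}" if "i < n" "j < m" for i j
    using bij_betwE[OF bij] that by simp
  show ?thesis
  proof
    show "inj_on \<sigma> {..<n}"
    proof (rule inj_onI)
      fix i i' assume i: "i \<in> {..<n}" "i' \<in> {..<n}" "\<sigma> i = \<sigma> i'"
      then have "f (i, 0) = f (i', 0)" using form nm by simp
      then show "i = i'"
        using bij_betw_imp_inj_on[OF bij] i nm by (auto dest!: inj_onD)
    qed
    show "\<sigma> ` {..<n} \<subseteq> {..<n}" using mem[of _ 0] nm by (force simp: \<sigma>_def)
    show "\<tau> ` {..<m} \<subseteq> {..<m}" using mem[of 0] nm by (force simp: \<tau>_def)
  qed (use form in auto)
qed

section \<open>The reflection in the center and the strategy of Rascal\<close>

definition mirror :: "nat \<times> nat \<Rightarrow> nat \<times> nat" where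
  "mirror v = (n - 1 - fst v, m - 1 - snd v)"

lemma mirror_in: "v \<in> pverts KK \<Longrightarrow> mirror v \<in> pverts KK"
  by (auto simp: mirror_def)

lemma mirror_mirror: "v \<in> pverts KK \<Longrightarrow> mirror (mirror v) = v"
  by (auto simp: mirror_def)

lemma automorphism_mirror: "automorphism KK mirror"
  unfolding automorphism_def
proof (intro conjI ballI)
  show "bij_betw mirror (pverts KK) (pverts KK)"
    by (rule bij_betw_byWitness[where f' = mirror])
      (use mirror_in mirror_mirror in \<open>auto simp del: pverts_KK\<close>)
  fix u v assume "u \<in> pverts KK" "v \<in> pverts KK"
  then show "(mirror u, mirror v) \<in> parcs KK \<longleftrightarrow> (u, v) \<in> parcs KK"
    by (cases u; cases v) (auto simp: mirror_def parcs_KK)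
qed

text \<open>The assumption on \<open>first\<close> makes Gentle be to move once the center, if it
  exists, is colored. From then on Rascal mirrors, and the reflection becomes a nontrivial
  automorphism that preserves the colors.\<close>

lemma Rascal_wins:
  assumes "n \<ge> 2" "m \<ge> 2"
    and first: "if even (n * m) then first = Gentle else first = Rascal"
  shows "distinguishing_game_number first KK = \<infinity>"
proof -
  have "\<not> winning_strategy_gentle KK d first s" if "0 < d" for d s
  proof
    assume win: "winning_strategy_gentle KK d first s"
    define centre where "centre = ((n - 1) div 2, (m - 1) div 2)"
    \<comment> \<open>The color 0 of the opening move is available because \<open>0 < d\<close>; any
      other color would serve as well.\<close>
    define p where "p = (if even (n * m) then [] else [(centre, 0::nat)])"
    have centre_iff: "mirror v = v \<longleftrightarrow> v = centre" if "odd (n * m)" "v \<in> pverts KK" for v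
    proof -
      have "odd n" "odd m" using that(1) by simp_all
      then obtain a b where ab: "n = 2 * a + 1" "m = 2 * b + 1" by (blast elim: oddE)
      have "n - 1 - x = x \<longleftrightarrow> x = (n - 1) div 2" if "x < n" for x using ab that by auto
      moreover have "m - 1 - y = y \<longleftrightarrow> y = (m - 1) div 2" if "y < m" for y
        using ab that by auto
      ultimately show ?thesis
        using that(2) unfolding mirror_def centre_def by (cases v) simp
    qed
    have centre_in: "centre \<in> pverts KK" using assms by (auto simp: centre_def)
    have "\<exists>q. legal_play KK d q \<and> follows_gentle first s q \<and> finished KK q \<and>
           (\<forall>v\<in>pverts KK. map_of q (mirror v) = map_of q v)"
    proof (rule mirror_play[where p = p, OF _ win mirror_in mirror_mirror])
      have *: "legal_play KK d [(centre, 0)]"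
        using centre_in legal_play_snoc[of KK d "[]" "(centre, 0)"] \<open>0 < d\<close>
        by (simp add: legal_move_def colored_def)
      show "legal_play KK d p" using * by (simp add: p_def)
      show "follows_gentle first s p"
        using first follows_gentle_snoc[of first s "[]" "(centre, 0)"]
        by (auto simp: p_def split: if_splits)
      show "to_move first p = Gentle"
        using first by (auto simp: p_def to_move_def split: if_splits)
      fix v assume v: "v \<in> pverts KK"
      have "mirror v = centre \<longleftrightarrow> v = centre" if "odd (n * m)"
        using centre_iff[OF that] mirror_mirror[OF v] centre_in v by metis
      then show "map_of p (mirror v) = map_of p v" by (auto simp: p_def)
      assume fixed: "mirror v = v"
      show "v \<in> colored p"
      proof (cases "even (n * m)")
        case True
        from fixed v have "2 * fst v + 1 = n" "2 * snd v + 1 = m"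
          by (auto simp: mirror_def)
        then have "odd n" "odd m" by presburger+
        then have "odd (n * m)" by simp
        with True show ?thesis by simp
      next
        case False
        then show ?thesis using centre_iff v fixed by (simp add: p_def colored_def)
      qed
    qed simp
    then obtain q where q: "legal_play KK d q" "follows_gentle first s q" "finished KK q"
      "\<forall>v\<in>pverts KK. map_of q (mirror v) = map_of q v" by blast
    then have "distinguishing KK (final_coloring q)"
      using win unfolding winning_strategy_gentle_def by blast
    moreover have "\<forall>v\<in>pverts KK. final_coloring q (mirror v) = final_coloring q v"
      using q(4) by (simp add: final_coloring_def)
    ultimately have "\<forall>v\<in>pverts KK. mirror v = v"
      using automorphism_mirror unfolding distinguishing_def by blast
    then have "mirror (0, 0) = (0, 0)" using assms by simp
    then show False using assms by (simp add: mirror_def)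
  qed
  then have none: "{enat d | d. 0 < d \<and> (\<exists>s. winning_strategy_gentle KK d first s)} = {}"
    by blast
  show ?thesis unfolding distinguishing_game_number_def none by (simp add: Inf_enat_def)
qed

section \<open>Columns with a matching\<close>

text \<open>The fixed points of \<open>\<mu>\<close> are the unmatched rows: once they are colored, every move of Rascal
  in the column can be answered in the matched row.\<close>

definition opened :: "(nat \<times> nat \<rightharpoonup> nat) \<Rightarrow> nat \<Rightarrow> (nat \<Rightarrow> nat) \<Rightarrow> bool" where
  "opened c j \<mu> \<longleftrightarrow> (\<forall>i<n. \<mu> i = i \<longrightarrow> c (i, j) \<noteq> None) \<and>
     (\<forall>i<n. c (i, j) \<noteq> None \<longrightarrow> c (\<mu> i, j) \<noteq> None \<and> (\<mu> i \<noteq> i \<longrightarrow> c (\<mu> i, j) \<noteq> c (i, j)))"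

definition full :: "(nat \<times> nat \<rightharpoonup> nat) \<Rightarrow> nat \<Rightarrow> bool" where
  "full c j \<longleftrightarrow> (\<forall>i<n. c (i, j) \<noteq> None)"

text \<open>The modulus is the number of colors, so the choices for a single entry produce every
  residue exactly once. The value is meaningful for full columns only, since an uncolored entry
  contributes \<open>the None\<close>.\<close>

definition colsum :: "(nat \<times> nat \<rightharpoonup> nat) \<Rightarrow> nat \<Rightarrow> nat" where
  "colsum c j = (\<Sum>i<n. the (c (i, j))) mod (m + 1)"

definition distinct_sums :: "(nat \<times> nat \<rightharpoonup> nat) \<Rightarrow> bool" where
  "distinct_sums c \<longleftrightarrow> inj_on (colsum c) {j. j < m \<and> full c j}"

definition row_involution :: "(nat \<Rightarrow> nat) \<Rightarrow> bool" where
  "row_involution \<mu> \<longleftrightarrow> (\<forall>i<n. \<mu> i < n \<and> \<mu> (\<mu> i) = i)"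

lemma full_cong: "(\<And>i. c' (i, j) = c (i, j)) \<Longrightarrow> full c' j = full c j"
  by (simp add: full_def)

lemma colsum_cong: "(\<And>i. c' (i, j) = c (i, j)) \<Longrightarrow> colsum c' j = colsum c j"
  by (simp add: colsum_def)

lemma opened_cong: "(\<And>i. c' (i, j) = c (i, j)) \<Longrightarrow> opened c' j \<mu> = opened c j \<mu>"
  by (simp add: opened_def)

text \<open>At most \<open>m - 1\<close> colors repeat the sum of another full column and one repeats the color of
  the matched row, which leaves one of the \<open>m + 1\<close> colors.\<close>

lemma reply_in_column:
  assumes \<mu>: "row_involution \<mu>" and op: "opened c j \<mu>" and ds: "distinct_sums c"
    and i: "i < n" and j: "j < m" and free: "c (i, j) = None"
  shows "\<mu> i < n \<and> \<mu> i \<noteq> i \<and> c (\<mu> i, j) = None \<and>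
    (\<exists>k'<m + 1. opened (c((i, j) \<mapsto> k, (\<mu> i, j) \<mapsto> k')) j \<mu> \<and>
       distinct_sums (c((i, j) \<mapsto> k, (\<mu> i, j) \<mapsto> k')))"
proof -
  have \<mu>i: "\<mu> i < n" "\<mu> (\<mu> i) = i" using \<mu> i by (auto simp: row_involution_def)
  have ne: "\<mu> i \<noteq> i" using op i free by (auto simp: opened_def)
  have free': "c (\<mu> i, j) = None"
  proof (rule ccontr)
    assume "c (\<mu> i, j) \<noteq> None"
    then have "c (\<mu> (\<mu> i), j) \<noteq> None" using op \<mu>i(1) unfolding opened_def by blast
    then show False using \<mu>i free by simp
  qed
  define c' where "c' k' = c((i, j) \<mapsto> k, (\<mu> i, j) \<mapsto> k')" for k'
  \<comment> \<open>\<open>S\<close> is the part of the sum that does not depend on the answer.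
    Uncolored rows contribute the fixed number \<open>the None\<close>, so the formula below holds
    whether or not the answer fills the column.\<close>
  define S where "S = (\<Sum>a\<in>{..<n} - {\<mu> i}. the ((c((i, j) \<mapsto> k)) (a, j)))"
  have colsum_j: "colsum (c' k') j = (S + k') mod (m + 1)" for k'
  proof -
    have "(\<Sum>a<n. the (c' k' (a, j))) =
        the (c' k' (\<mu> i, j)) + (\<Sum>a\<in>{..<n} - {\<mu> i}. the (c' k' (a, j)))"
      using \<mu>i(1) by (subst sum.remove[of _ "\<mu> i"]) auto
    moreover have "(\<Sum>a\<in>{..<n} - {\<mu> i}. the (c' k' (a, j))) = S"
      unfolding S_def c'_def by (intro sum.cong) auto
    ultimately show ?thesis by (simp add: colsum_def c'_def add.commute)
  qed
  \<comment> \<open>Sums of columns that are not full are avoided too; this is affordable because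
    there are only m - 1 other columns.\<close>
  define U where "U = colsum c ` ({..<m} - {j})"
  define bad where "bad = {k'. k' < m + 1 \<and> (S + k') mod (m + 1) \<in> U}"
  have inj: "inj_on (\<lambda>k'. (S + k') mod (m + 1)) {..<m + 1}"
  proof (rule inj_onI)
    fix a b assume ab: "a \<in> {..<m + 1}" "b \<in> {..<m + 1}" "(S + a) mod (m + 1) = (S + b) mod (m + 1)"
    show "a = b"
      using ab cong_add_lcancel_nat[of S a b "m + 1"] cong_less_modulus_unique_nat[of a b "m + 1"]
      by (simp add: cong_def)
  qed
  have "inj_on (\<lambda>k'. (S + k') mod (m + 1)) bad"
    by (rule inj_on_subset[OF inj]) (auto simp: bad_def)
  then have "card bad \<le> card U"
    by (rule card_inj_on_le) (auto simp: bad_def U_def)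
  also have "\<dots> \<le> card ({..<m} - {j})" unfolding U_def by (rule card_image_le) simp
  also have "\<dots> = m - 1" using j by simp
  finally have "card bad \<le> m - 1" .
  moreover have fin: "finite bad" by (simp add: bad_def)
  ultimately have "card (insert k bad) < card {..<m + 1}"
    using j by (auto simp: card_insert_if)
  moreover have "finite (insert k bad)" using fin by simp
  ultimately have "\<not> {..<m + 1} \<subseteq> insert k bad" by (meson card_mono not_le)
  then obtain k' where k': "k' < m + 1" "k' \<noteq> k" "(S + k') mod (m + 1) \<notin> U"
    by (auto simp: bad_def)
  have "opened (c' k') j \<mu>"
    unfolding opened_def
  proof (intro conjI allI impI)
    fix a assume a: "a < n"
    have \<mu>a: "\<mu> (\<mu> a) = a" using \<mu> a by (simp add: row_involution_def)
    have new: "c' k' (i, j) = Some k" "c' k' (\<mu> i, j) = Some k'"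
      using ne by (simp_all add: c'_def)
    have old: "c' k' (b, j) = c (b, j)" if "b \<noteq> i" "b \<noteq> \<mu> i" for b
      using that by (simp add: c'_def)
    show "c' k' (a, j) \<noteq> None" if "\<mu> a = a"
    proof -
      have "a \<noteq> i" "a \<noteq> \<mu> i" using that ne \<mu>i by auto
      then show ?thesis using old[of a] op a that by (simp add: opened_def)
    qed
    assume *: "c' k' (a, j) \<noteq> None"
    have "c' k' (\<mu> a, j) \<noteq> None \<and> (\<mu> a \<noteq> a \<longrightarrow> c' k' (\<mu> a, j) \<noteq> c' k' (a, j))"
    proof (cases "a = i \<or> a = \<mu> i")
      case True
      then show ?thesis using new \<mu>i(2) k'(2) by auto
    next
      case False
      then have "\<mu> a \<noteq> i" "\<mu> a \<noteq> \<mu> i" using \<mu>a \<mu>i(2) by auto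
      then show ?thesis using False * old op a by (simp add: opened_def)
    qed
    then show "c' k' (\<mu> a, j) \<noteq> None" "\<mu> a \<noteq> a \<Longrightarrow> c' k' (\<mu> a, j) \<noteq> c' k' (a, j)" by blast+
  qed
  moreover have "distinct_sums (c' k')"
  proof -
    have other: "colsum (c' k') b = colsum c b" "full (c' k') b = full c b" if "b \<noteq> j" for b
      using that by (auto intro!: colsum_cong full_cong simp: c'_def)
    have notin: "colsum (c' k') j \<noteq> colsum c b" if "b < m" "b \<noteq> j" for b
      using k'(3) that unfolding colsum_j U_def by auto
    show ?thesis
      unfolding distinct_sums_def
    proof (rule inj_onI)
      fix a b assume ab: "a \<in> {b. b < m \<and> full (c' k') b}" "b \<in> {b. b < m \<and> full (c' k') b}"
        "colsum (c' k') a = colsum (c' k') b"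
      show "a = b"
      proof (cases "a = j \<or> b = j")
        case True
        then show ?thesis using ab notin other by (metis mem_Collect_eq)
      next
        case False
        then show ?thesis using ab other ds by (auto simp: distinct_sums_def dest: inj_onD)
      qed
    qed
  qed
  ultimately show ?thesis using \<mu>i(1) ne free' k'(1) unfolding c'_def by blast
qed

lemma distinguishing_full_coloring:
  assumes nm: "n \<ge> 2" "m \<ge> 2" "n \<noteq> m"
    and dom: "pverts KK \<subseteq> dom c" and ds: "distinct_sums c"
    and op: "\<And>j. j < m \<Longrightarrow> opened c j (\<mu> j)"
    and cover: "\<And>a b. \<lbrakk>a < n; b < n; a \<noteq> b\<rbrakk> \<Longrightarrow> \<exists>j<m. \<mu> j a = b"
  shows "distinguishing KK (\<lambda>v. the (c v))"
  unfolding distinguishing_def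
proof (intro allI impI, elim conjE)
  fix f assume f: "automorphism KK f" and pres: "\<forall>v\<in>pverts KK. the (c (f v)) = the (c v)"
  obtain \<sigma> \<tau> where \<sigma>: "inj_on \<sigma> {..<n}" "\<sigma> ` {..<n} \<subseteq> {..<n}"
    and \<tau>: "\<tau> ` {..<m} \<subseteq> {..<m}"
    and form: "\<And>i j. \<lbrakk>i < n; j < m\<rbrakk> \<Longrightarrow> f (i, j) = (\<sigma> i, \<tau> j)"
    using automorphism_product_form[OF nm f] by metis
  have some: "c (i, j) \<noteq> None" if "i < n" "j < m" for i j using dom that by (auto simp: domD)
  have eq: "the (c (\<sigma> i, \<tau> j)) = the (c (i, j))" if "i < n" "j < m" for i j
    using pres form that by force
  have img: "\<sigma> ` {..<n} = {..<n}" using \<sigma> by (simp add: endo_inj_surj)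
  \<comment> \<open>Column \<open>\<tau> j\<close> carries the colors of column \<open>j\<close>,
    permuted by \<sigma>, so the two columns have equal sums.\<close>
  have \<tau>_id: "\<tau> j = j" if j: "j < m" for j
  proof -
    have "(\<Sum>i<n. the (c (i, \<tau> j))) = (\<Sum>i\<in>\<sigma> ` {..<n}. the (c (i, \<tau> j)))" by (simp add: img)
    also have "\<dots> = (\<Sum>i<n. the (c (\<sigma> i, \<tau> j)))" using \<sigma>(1) by (simp add: sum.reindex)
    also have "\<dots> = (\<Sum>i<n. the (c (i, j)))" using eq j by simp
    finally have "colsum c (\<tau> j) = colsum c j" by (simp add: colsum_def)
    moreover have "\<tau> j < m" using \<tau> j by auto
    ultimately show ?thesis
      using ds j some by (auto simp: distinct_sums_def full_def dest: inj_onD)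
  qed
  \<comment> \<open>In a column that matches \<open>i\<close> with \<open>\<sigma> i\<close> the two
    rows have different colors, but since every column is fixed, the automorphism would make them
    equal.\<close>
  have \<sigma>_id: "\<sigma> i = i" if i: "i < n" for i
  proof (rule ccontr)
    assume ne: "\<sigma> i \<noteq> i"
    have \<sigma>i: "\<sigma> i < n" using \<sigma>(2) i by auto
    obtain j where j: "j < m" "\<mu> j i = \<sigma> i" using cover[OF i \<sigma>i] ne by auto
    have "c (\<sigma> i, j) \<noteq> c (i, j)" using op[OF j(1)] i j ne some by (auto simp: opened_def)
    moreover have "the (c (\<sigma> i, j)) = the (c (i, j))" using eq[OF i j(1)] \<tau>_id j by simp
    ultimately show False using some[OF i j(1)] some[OF \<sigma>i j(1)] by (auto simp: option.expand)
  qed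
  show "\<forall>v\<in>pverts KK. f v = v" using form \<tau>_id \<sigma>_id by auto
qed

text \<open>Serves moves that fill no column, such as the opening of a fresh one.\<close>

lemma distinct_sums_transfer:
  assumes ds: "distinct_sums c"
    and "\<And>j. \<lbrakk>j < m; full c' j\<rbrakk> \<Longrightarrow> \<forall>i. c' (i, j) = c (i, j)"
  shows "distinct_sums c'"
  unfolding distinct_sums_def
proof (rule inj_onI)
  fix a b assume ab: "a \<in> {j. j < m \<and> full c' j}" "b \<in> {j. j < m \<and> full c' j}"
    "colsum c' a = colsum c' b"
  then have eq: "\<forall>i. c' (i, a) = c (i, a)" "\<forall>i. c' (i, b) = c (i, b)" using assms(2) by auto
  then have "full c a" "full c b" "colsum c a = colsum c b"
    using ab full_cong[of c' a c] full_cong[of c' b c] colsum_cong[of c' a c]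
      colsum_cong[of c' b c] by auto
  then show "a = b" using ds ab by (auto simp: distinct_sums_def dest: inj_onD)
qed

section \<open>Matchings of the rows\<close>

text \<open>The map sending i to 2x - i on the residues modulo \<open>N\<close>; the summand
  \<open>N\<close> keeps the subtraction from truncating.\<close>

definition reflection :: "nat \<Rightarrow> nat \<Rightarrow> nat \<Rightarrow> nat" where
  "reflection N x i = (2 * x + N - i) mod N"

text \<open>A condition symmetric in \<open>i\<close> and \<open>b\<close>, from which the
  involution property, the fixed points and the covering of all pairs are read off.\<close>

lemma reflection_eq_iff:
  assumes "i < N" "b < N"
  shows "reflection N x i = b \<longleftrightarrow> [i + b = 2 * x] (mod N)"
proof -
  let ?r = "reflection N x i"
  have "[i + ?r = i + (2 * x + N - i)] (mod N)"
    unfolding reflection_def by (simp add: cong_def mod_add_right_eq)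
  then have r: "[i + ?r = 2 * x] (mod N)" using assms by (simp add: cong_def)
  have "?r < N" using assms by (simp add: reflection_def)
  then have "?r = b \<longleftrightarrow> [?r = b] (mod N)"
    using assms by (auto simp: cong_def)
  also have "\<dots> \<longleftrightarrow> [i + ?r = i + b] (mod N)" by (simp add: cong_add_lcancel_nat)
  also have "\<dots> \<longleftrightarrow> [i + b = 2 * x] (mod N)"
    using r by (metis cong_sym cong_trans)
  finally show ?thesis .
qed

lemma reflection_less: "0 < N \<Longrightarrow> reflection N x i < N"
  by (simp add: reflection_def)

lemma reflection_reflection:
  assumes "i < N"
  shows "reflection N x (reflection N x i) = i"
proof -
  have r: "reflection N x i < N" using assms by (intro reflection_less) simp
  have "[i + reflection N x i = 2 * x] (mod N)" using assms r reflection_eq_iff by blast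
  then show ?thesis using assms r by (simp add: reflection_eq_iff add.commute)
qed

text \<open>2 is invertible modulo an odd number.\<close>

lemma reflection_fixed_iff:
  assumes "odd N" "i < N" "x < N"
  shows "reflection N x i = i \<longleftrightarrow> i = x"
proof -
  have "reflection N x i = i \<longleftrightarrow> [2 * i = 2 * x] (mod N)"
    using assms by (simp add: reflection_eq_iff mult_2)
  also have "\<dots> \<longleftrightarrow> [i = x] (mod N)"
    using assms by (intro cong_mult_lcancel_nat) (simp add: coprime_commute)
  also have "\<dots> \<longleftrightarrow> i = x" using assms by (auto simp: cong_def)
  finally show ?thesis .
qed

lemma reflection_cover:
  assumes "odd N" "a < N" "b < N"
  obtains x where "x < N" "reflection N x a = b"
proof
  \<comment> \<open>Half of a + b: for odd \<open>N\<close>, (N + 1) / 2 is the inverse of 2 modulo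
    \<open>N\<close>.\<close>
  let ?x = "((a + b) * ((N + 1) div 2)) mod N"
  show "?x < N" using assms by simp
  have "2 * ((a + b) * ((N + 1) div 2)) = (a + b) + N * (a + b)"
    using assms(1) by (auto elim!: oddE simp: algebra_simps)
  then have "[2 * ?x = a + b] (mod N)"
    unfolding cong_def by (metis mod_mult_right_eq mod_mult_self2)
  then show "reflection N ?x a = b"
    using assms by (simp add: reflection_eq_iff cong_sym)
qed

lemma row_involution_reflection:
  "0 < n \<Longrightarrow> row_involution (reflection n x)"
  by (simp add: row_involution_def reflection_less reflection_reflection)

text \<open>The classical one-factorization of the complete graph on an even number of vertices: the
  center \<open>x\<close> of the reflection is matched with the additional point \<open>n - 1\<close>.\<close>

definition matching :: "nat \<Rightarrow> nat \<Rightarrow> nat" where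
  "matching x i =
     (if i = n - 1 then x else if i = x then n - 1 else reflection (n - 1) x i)"

text \<open>Since n - 1 is odd, the reflection modulo n - 1 fixes only its center, and exactly this
  row is paired with the additional point.\<close>

lemma matching_involution:
  assumes "even n" "n \<ge> 2" "x < n - 1"
  shows "row_involution (matching x)" and "\<And>i. i < n \<Longrightarrow> matching x i \<noteq> i"
proof -
  have N: "odd (n - 1)" "0 < n - 1" using assms by auto
  have r: "reflection (n - 1) x i < n - 1" "reflection (n - 1) x i \<noteq> i"
    "reflection (n - 1) x i \<noteq> x" "reflection (n - 1) x (reflection (n - 1) x i) = i"
    if "i < n - 1" "i \<noteq> x" for i
  proof -
    show 1: "reflection (n - 1) x i < n - 1" using N by (intro reflection_less)
    show "reflection (n - 1) x i \<noteq> i" using reflection_fixed_iff[OF N(1)] that assms by blast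
    show 2: "reflection (n - 1) x (reflection (n - 1) x i) = i"
      using that by (intro reflection_reflection)
    show "reflection (n - 1) x i \<noteq> x"
      using 2 reflection_fixed_iff[OF N(1) assms(3) assms(3)] that by metis
  qed
  have lt: "i < n - 1" if "i < n" "i \<noteq> n - 1" for i using that by simp
  show "row_involution (matching x)"
    unfolding row_involution_def
  proof (intro allI impI)
    fix i assume i: "i < n"
    consider "i = n - 1" | "i = x" "i \<noteq> n - 1" | "i \<noteq> x" "i < n - 1" using i by linarith
    then show "matching x i < n \<and> matching x (matching x i) = i"
    proof cases
      case 3
      then show ?thesis using r[of i] by (simp add: matching_def)
    qed (use assms in \<open>auto simp: matching_def\<close>)
  qed
  show "matching x i \<noteq> i" if "i < n" for i
    using r(2)[of i] lt[OF that] assms by (auto simp: matching_def)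
qed

text \<open>A pair containing n - 1 lies in the matching centered at its other row; any other pair
  lies in the one centered at half its sum modulo n - 1.\<close>

lemma matching_cover:
  assumes "even n" "n \<ge> 2" "a < n" "b < n" "a \<noteq> b"
  obtains x where "x < n - 1" "matching x a = b"
proof -
  have N: "odd (n - 1)" using assms by auto
  consider "a = n - 1" | "b = n - 1" "a < n - 1" | "a < n - 1" "b < n - 1"
    using assms by linarith
  then show thesis
  proof cases
    case 1
    then show thesis using assms by (intro that[of b]) (auto simp: matching_def)
  next
    case 2
    then show thesis using assms by (intro that[of a]) (auto simp: matching_def)
  next
    case 3
    obtain x where x: "x < n - 1" "reflection (n - 1) x a = b"
      using reflection_cover[OF N 3] .
    moreover from this have "a \<noteq> x"
      using reflection_fixed_iff[OF N 3(1) x(1)] assms by auto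
    ultimately show thesis using 3 by (intro that[of x]) (auto simp: matching_def)
  qed
qed

section \<open>Strategies of Gentle\<close>

text \<open>The matchings have no fixed rows, so even an empty column is \<open>opened\<close>, and
  every move of Rascal can be answered in its own column.\<close>

lemma Gentle_wins_even:
  assumes nm: "n \<ge> 2" "m \<ge> 2" "n \<noteq> m" and "even n" "m \<ge> n - 1"
  shows "distinguishing_game_number Rascal KK \<le> enat (m + 1)"
proof (rule game_number_le)
  \<comment> \<open>The n - 1 matchings are assigned to the columns cyclically; each of them occurs
    because m is at least n - 1.\<close>
  define \<mu> where "\<mu> j = matching (j mod (n - 1))" for j
  have \<mu>: "row_involution (\<mu> j)" and ne: "\<And>i. i < n \<Longrightarrow> \<mu> j i \<noteq> i" for j
    using matching_involution[of "j mod (n - 1)"] assms by (auto simp: \<mu>_def)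
  define J where "J c \<longleftrightarrow> distinct_sums c \<and> (\<forall>j<m. opened c j (\<mu> j))" for c
  show "\<exists>s. winning_strategy_gentle KK (m + 1) Rascal s"
  proof (rule winning_strategy_from_invariant[where J = J])
    have "\<not> full Map.empty j" for j using nm by (auto simp: full_def intro: exI[of _ 0])
    then show "if Rascal = Rascal then J Map.empty else \<exists>w\<in>pverts KK. \<exists>k<m + 1. J [w \<mapsto> k]"
      using ne by (simp add: J_def distinct_sums_def opened_def)
  next
    fix c v k assume J: "J c" and v: "v \<in> pverts KK" "c v = None"
    obtain i j where ij: "v = (i, j)" "i < n" "j < m" using v by auto
    then obtain k' where k': "\<mu> j i < n" "\<mu> j i \<noteq> i" "c (\<mu> j i, j) = None" "k' < m + 1"
      "opened (c(v \<mapsto> k, (\<mu> j i, j) \<mapsto> k')) j (\<mu> j)"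
      "distinct_sums (c(v \<mapsto> k, (\<mu> j i, j) \<mapsto> k'))"
      using reply_in_column[OF \<mu>[of j], of c j i k] J v by (auto simp: J_def)
    have "opened (c(v \<mapsto> k, (\<mu> j i, j) \<mapsto> k')) b (\<mu> b)" if "b < m" for b
    proof (cases "b = j")
      case False
      then show ?thesis
        using J that ij opened_cong[of "c(v \<mapsto> k, (\<mu> j i, j) \<mapsto> k')" b c] by (auto simp: J_def)
    qed (use k' in simp)
    then have "J (c(v \<mapsto> k, (\<mu> j i, j) \<mapsto> k'))" using k' by (simp add: J_def)
    then show "\<exists>w\<in>pverts KK. \<exists>k'<m + 1. (c(v \<mapsto> k)) w = None \<and> J (c(v \<mapsto> k, w \<mapsto> k'))"
      using k' ij by (intro bexI[of _ "(\<mu> j i, j)"] exI[of _ k']) auto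
  next
    fix c assume J: "J c" and dom: "pverts KK \<subseteq> dom c"
    have "\<exists>j<m. \<mu> j a = b" if ab: "a < n" "b < n" "a \<noteq> b" for a b
    proof -
      obtain x where "x < n - 1" "matching x a = b"
        using matching_cover[OF assms(4) nm(1) ab] .
      then show ?thesis using assms(5) by (intro exI[of _ x]) (simp add: \<mu>_def)
    qed
    then show "distinguishing KK (\<lambda>v. the (c v))"
      using distinguishing_full_coloring[OF nm dom] J unfolding J_def by blast
  qed
qed simp

section \<open>An odd number of rows: opening the columns\<close>

lemma open_fresh_column:
  assumes "odd n" "n \<ge> 2" "i < n" "j < m" and fresh: "\<forall>a<n. c (a, j) = None"
    and ds: "distinct_sums c"
  shows "opened (c((i, j) \<mapsto> k)) j (reflection n i)" and "distinct_sums (c((i, j) \<mapsto> k))"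
proof -
  have col: "(c((i, j) \<mapsto> k)) (a, j) \<noteq> None \<longleftrightarrow> a = i" if "a < n" for a
    using fresh that by auto
  have fix_iff: "reflection n i a = a \<longleftrightarrow> a = i" if "a < n" for a
    using assms that by (intro reflection_fixed_iff)
  show "opened (c((i, j) \<mapsto> k)) j (reflection n i)"
    unfolding opened_def
  proof (intro conjI allI impI)
    fix a assume a: "a < n"
    show "(c((i, j) \<mapsto> k)) (a, j) \<noteq> None" if "reflection n i a = a"
      using that fix_iff[OF a] col[OF a] by blast
    assume "(c((i, j) \<mapsto> k)) (a, j) \<noteq> None"
    then have "a = i" using col[OF a] by blast
    then have "reflection n i a = a" using fix_iff[OF a] by blast
    then show "(c((i, j) \<mapsto> k)) (reflection n i a, j) \<noteq> None"
      and "reflection n i a \<noteq> a \<Longrightarrow>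
        (c((i, j) \<mapsto> k)) (reflection n i a, j) \<noteq> (c((i, j) \<mapsto> k)) (a, j)"
      using \<open>a = i\<close> by auto
  qed
  \<comment> \<open>A column has at least two rows, so its first move does not fill it and no new
    sum has to be compared.\<close>
  have "\<not> full (c((i, j) \<mapsto> k)) j"
  proof
    assume "full (c((i, j) \<mapsto> k)) j"
    then have "a = i" if "a < n" for a using col that unfolding full_def by blast
    from this[of 0] this[of 1] assms show False by simp
  qed
  then show "distinct_sums (c((i, j) \<mapsto> k))"
    by (intro distinct_sums_transfer[OF ds]) auto
qed

text \<open>The set \<open>W\<close> consists of the columns that are not fresh, and \<open>x j\<close> is the row of the first
  move in column \<open>j\<close>. Gentle opens every second fresh column, at a row not in the image of \<open>x\<close>,
  whence the bound on the number of missing rows; the summand 2 accounts for Rascal's first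
  move, which always gives a new row.\<close>

definition opening_state :: "nat set \<Rightarrow> (nat \<Rightarrow> nat) \<Rightarrow> (nat \<times> nat \<rightharpoonup> nat) \<Rightarrow> bool" where
  "opening_state W x c \<longleftrightarrow> distinct_sums c \<and> W \<subseteq> {..<m} \<and>
     (\<forall>j\<in>{..<m} - W. \<forall>i<n. c (i, j) = None) \<and>
     (\<forall>j\<in>W. x j < n \<and> opened c j (reflection n (x j))) \<and>
     even (card ({..<m} - W)) \<and>
     2 * card ({..<n} - x ` W) \<le> card ({..<m} - W) + (if W = {} then 2 else 0)"

text \<open>The matching of column \<open>j\<close> is already settled, so answering in the matched
  row changes neither \<open>W\<close> nor \<open>x\<close>.\<close>

lemma opening_state_in_column:
  assumes st: "opening_state W x c" and "i < n" "j \<in> W" and free: "c (i, j) = None"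
  shows "\<exists>w\<in>pverts KK. \<exists>k'<m + 1. (c((i, j) \<mapsto> k)) w = None \<and>
           opening_state W x (c((i, j) \<mapsto> k, w \<mapsto> k'))"
proof -
  let ?\<mu> = "reflection n (x j)"
  have j: "j < m" using st assms by (auto simp: opening_state_def)
  have \<mu>: "row_involution ?\<mu>" using assms by (intro row_involution_reflection) simp
  have "opened c j ?\<mu>" "distinct_sums c" using st assms by (auto simp: opening_state_def)
  from reply_in_column[OF \<mu> this assms(2) j free, of k] obtain k' where
    k': "?\<mu> i < n" "?\<mu> i \<noteq> i" "c (?\<mu> i, j) = None" "k' < m + 1"
      "opened (c((i, j) \<mapsto> k, (?\<mu> i, j) \<mapsto> k')) j ?\<mu>"
      "distinct_sums (c((i, j) \<mapsto> k, (?\<mu> i, j) \<mapsto> k'))" by blast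
  let ?c = "c((i, j) \<mapsto> k, (?\<mu> i, j) \<mapsto> k')"
  have "opened ?c b (reflection n (x b))" if "b \<in> W" for b
  proof (cases "b = j")
    case False
    then show ?thesis using st that opened_cong[of ?c b c] by (auto simp: opening_state_def)
  qed (use k' in simp)
  moreover have "\<forall>a<n. ?c (a, b) = None" if "b \<in> {..<m} - W" for b
    using st that assms by (auto simp: opening_state_def)
  ultimately have "opening_state W x ?c" using st k'(6) by (auto simp: opening_state_def)
  then show ?thesis using k' j assms(2) by (intro bexI[of _ "(?\<mu> i, j)"] exI[of _ k']) auto
qed

text \<open>The number of fresh columns is even, so when Rascal opens one, a second one is left for
  Gentle to open. Each such exchange uses two fresh columns and removes at least one missing row, as
  long as there is one, which preserves the bound.\<close>

lemma opening_state_new_column: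
  assumes odd: "odd n" "n \<ge> 2" and st: "opening_state W x c" and i: "i < n" and j: "j \<in> {..<m} - W"
  shows "\<exists>w\<in>pverts KK. \<exists>k'<m + 1. (c((i, j) \<mapsto> k)) w = None \<and>
           (\<exists>W' x'. opening_state W' x' (c((i, j) \<mapsto> k, w \<mapsto> k')))"
proof -
  define F where "F = {..<m} - W"
  define U where "U = {..<n} - x ` W"
  have fin: "finite F" "finite U" by (simp_all add: F_def U_def)
  have F: "even (card F)" "j \<in> F" and U: "2 * card U \<le> card F + (if W = {} then 2 else 0)"
    and WM: "W \<subseteq> {..<m}"
    and fresh: "\<And>b a. \<lbrakk>b \<in> F; a < n\<rbrakk> \<Longrightarrow> c (a, b) = None"
    using st j by (auto simp: opening_state_def F_def U_def)
  have "card F \<noteq> 0" using fin F(2) by auto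
  then have "card F \<ge> 2" using F(1) by (cases "card F = 1") auto
  then have "card (F - {j}) \<noteq> 0" using fin F(2) by simp
  then obtain j' where j': "j' \<in> F" "j' \<noteq> j" by (metis DiffE card.empty ex_in_conv singletonI)
  have jm: "j < m" "j' < m" "j \<notin> W" "j' \<notin> W" using F(2) j' by (auto simp: F_def)
  \<comment> \<open>A row still missing after Rascal's move; if none is missing, any row will do,
    and 0 is taken.\<close>
  define r where "r = (if U - {i} = {} then 0 else SOME r. r \<in> U - {i})"
  have rU: "r \<in> U - {i}" if "U - {i} \<noteq> {}"
    using that some_in_eq[of "U - {i}"] by (simp add: r_def)
  then have r: "r < n" using odd by (cases "U - {i} = {}") (auto simp: r_def U_def)
  define c1 where "c1 = c((i, j) \<mapsto> k)"
  define c2 where "c2 = c1((r, j') \<mapsto> 0)"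
  define W' where "W' = insert j' (insert j W)"
  define x' where "x' = x(j := i, j' := r)"
  have c1: "opened c1 j (reflection n i)" "distinct_sums c1"
    using open_fresh_column[OF odd i jm(1), of c k] fresh F(2) st
    by (auto simp: c1_def opening_state_def)
  have fresh1: "\<forall>a<n. c1 (a, j') = None" using fresh j' by (simp add: c1_def)
  have c2: "opened c2 j' (reflection n r)" "distinct_sums c2"
    using open_fresh_column[OF odd r jm(2) fresh1 c1(2), of 0] by (simp_all add: c2_def)
  have c2_eq: "c2 (a, b) = c (a, b)" if "b \<noteq> j" "b \<noteq> j'" for a b
    using that by (simp add: c1_def c2_def)
  have F': "{..<m} - W' = F - {j} - {j'}" by (auto simp: F_def W'_def)
  have card_F': "card ({..<m} - W') = card F - 2"
    unfolding F' using fin F(2) j' by simp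
  have U': "{..<n} - x' ` W' = U - {i} - {r}"
    using jm j' by (auto simp: U_def W'_def x'_def)
  \<comment> \<open>If \<open>W\<close> is empty, both \<open>i\<close> and \<open>r\<close> are new
    rows, which pays for the summand 2. Otherwise only \<open>r\<close> is certain to be new, and
    this matches the loss of two fresh columns.\<close>
  have "2 * card (U - {i} - {r}) \<le> card F - 2"
  proof (cases "U - {i} = {}")
    case True
    then have "U - {i} - {r} = {}" by blast
    then show ?thesis by (simp only: card.empty)
  next
    case False
    from rU[OF this] have card_r: "card (U - {i} - {r}) = card (U - {i}) - 1"
      using fin by (simp add: card_Diff_singleton)
    show ?thesis
    proof (cases "W = {}")
      case True
      then have "card (U - {i}) = card U - 1" using i by (simp add: U_def)
      then show ?thesis using card_r U True \<open>card F \<ge> 2\<close> by simp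
    next
      case False
      have "card (U - {i}) \<le> card U" using fin by (intro card_mono) auto
      then show ?thesis using card_r U False \<open>card F \<ge> 2\<close> by simp
    qed
  qed
  moreover have "even (card F - 2)" using F(1) by simp
  moreover have "x' b < n \<and> opened c2 b (reflection n (x' b))" if b: "b \<in> W'" for b
  proof -
    consider "b = j'" | "b = j" | "b \<in> W" "b \<noteq> j" "b \<noteq> j'" using b by (auto simp: W'_def)
    then show ?thesis
    proof cases
      case 1
      then show ?thesis using c2(1) r by (simp add: x'_def)
    next
      case 2
      then show ?thesis
        using c1(1) i j'(2) opened_cong[of c2 j c1] by (simp add: x'_def c2_def)
    next
      case 3
      then show ?thesis
        using st c2_eq opened_cong[of c2 b c] by (simp add: x'_def opening_state_def)
    qed
  qed
  moreover have "\<forall>a<n. c2 (a, b) = None" if "b \<in> {..<m} - W'" for b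
    using fresh that c2_eq unfolding F' by auto
  moreover have "W' \<subseteq> {..<m}" using WM jm by (auto simp: W'_def)
  ultimately have "opening_state W' x' c2"
    using c2(2) unfolding opening_state_def card_F' U' by simp
  then show ?thesis
    using fresh1 r jm unfolding c2_def c1_def
    by (intro bexI[of _ "(r, j')"] exI[of _ 0]) auto
qed

lemma Gentle_wins_odd:
  assumes nm: "n \<ge> 2" "m \<ge> 2" "n \<noteq> m" and "odd n"
    and bound: "if first = Rascal then even m \<and> m \<ge> 2 * n - 2 else odd m \<and> m \<ge> 2 * n - 1"
  shows "distinguishing_game_number first KK \<le> enat (m + 1)"
proof (rule game_number_le)
  define J where "J c \<longleftrightarrow> (\<exists>W x. opening_state W x c)" for c
  have "\<not> full Map.empty j" for j using nm by (auto simp: full_def intro: exI[of _ 0])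
  then have empty: "distinct_sums Map.empty" by (simp add: distinct_sums_def)
  show "\<exists>s. winning_strategy_gentle KK (m + 1) first s"
  proof (rule winning_strategy_from_invariant[where J = J])
    show "if first = Rascal then J Map.empty else \<exists>w\<in>pverts KK. \<exists>k<m + 1. J [w \<mapsto> k]"
    proof (cases "first = Rascal")
      case True
      \<comment> \<open>All n rows are missing and all m columns are fresh, so the bound reads 2n
        \<le> m + 2.\<close>
      then have "opening_state {} id Map.empty"
        using bound empty by (auto simp: opening_state_def)
      then show ?thesis using True by (auto simp: J_def)
    next
      case False
      have "card ({..<n} - {0}) = n - 1" "card ({..<m} - {0}) = m - 1" using nm by simp_all
      \<comment> \<open>Gentle opens column 0 at row 0. This leaves n - 1 missing rows and an even
        number m - 1 of fresh columns, so the bound reads 2(n - 1) \<le> m - 1.\<close>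
      then have "opening_state {0} (\<lambda>_. 0) [(0, 0) \<mapsto> 0]"
        using open_fresh_column[of 0 0 Map.empty 0] nm \<open>odd n\<close> empty bound False
        by (auto simp: opening_state_def)
      then have "\<exists>w\<in>pverts KK. \<exists>k<m + 1. J [w \<mapsto> k]"
        using nm by (intro bexI[of _ "(0, 0)"] exI[of _ 0]) (auto simp: J_def)
      then show ?thesis using False by simp
    qed
  next
    fix c v k assume J: "J c" and v: "v \<in> pverts KK" "c v = None"
    obtain i j where ij: "v = (i, j)" "i < n" "j < m" using v by auto
    obtain W x where st: "opening_state W x c" using J by (auto simp: J_def)
    show "\<exists>w\<in>pverts KK. \<exists>k'<m + 1. (c(v \<mapsto> k)) w = None \<and> J (c(v \<mapsto> k, w \<mapsto> k'))"
    proof (cases "j \<in> W")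
      case True
      then show ?thesis
        using opening_state_in_column[OF st ij(2) True, of k] v(2) unfolding ij(1) J_def by blast
    next
      case False
      then show ?thesis
        using opening_state_new_column[OF \<open>odd n\<close> nm(1) st ij(2), of j k] ij
        unfolding ij(1) J_def by blast
    qed
  next
    fix c assume J: "J c" and dom: "pverts KK \<subseteq> dom c"
    obtain W x where st: "opening_state W x c" using J by (auto simp: J_def)
    have "c (0, j) \<noteq> None" if "j < m" for j
    proof -
      have "(0, j) \<in> dom c" using that nm by (intro subsetD[OF dom]) simp
      then show ?thesis by (simp add: domIff)
    qed
    moreover have "W \<subseteq> {..<m}" "\<And>j. j \<in> {..<m} - W \<Longrightarrow> c (0, j) = None"
      using st nm by (simp_all add: opening_state_def)
    \<comment> \<open>No column is fresh at the end, so the bound leaves no row missing: every row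
      is the center of the reflection of some column.\<close>
    ultimately have W: "W = {..<m}" by blast
    then have "card ({..<n} - x ` W) = 0"
      using st nm by (auto simp: opening_state_def split: if_splits)
    then have rows: "{..<n} \<subseteq> x ` {..<m}" using W by simp
    have cover: "\<exists>j<m. reflection n (x j) a = b" if ab: "a < n" "b < n" for a b
    proof -
      obtain y where "y < n" "reflection n y a = b" using reflection_cover[OF \<open>odd n\<close> ab] .
      moreover from this rows obtain j where "j < m" "y = x j" by blast
      ultimately show ?thesis by blast
    qed
    show "distinguishing KK (\<lambda>v. the (c v))"
      by (rule distinguishing_full_coloring[OF nm dom, where \<mu> = "\<lambda>j. reflection n (x j)"])
        (use st W cover in \<open>auto simp: opening_state_def\<close>)
  qed
qed simp

end

theorem theorem3p1:
  fixes n m :: nat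
  assumes "n \<ge> 2" and "m \<ge> 2" and "n \<noteq> m"
  shows "(even (n * m) \<longrightarrow> D_G (complete_graph n \<box> complete_graph m) = \<infinity>) \<and>
         (odd (n * m) \<longrightarrow> D_R (complete_graph n \<box> complete_graph m) = \<infinity>) \<and>
         (even n \<and> m \<noteq> n \<and> m \<ge> n - 1 \<longrightarrow>
            D_R (complete_graph n \<box> complete_graph m) \<le> enat (m + 1)) \<and>
         (odd n \<and> even m \<and> m \<ge> 2 * n - 2 \<longrightarrow>
            D_R (complete_graph n \<box> complete_graph m) \<le> enat (m + 1)) \<and>
         (odd n \<and> odd m \<and> m \<ge> 2 * n - 1 \<longrightarrow>
            D_G (complete_graph n \<box> complete_graph m) \<le> enat (m + 1))"
proof (intro conjI impI; (elim conjE)?)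
  assume "even (n * m)"
  then show "D_G (complete_graph n \<box> complete_graph m) = \<infinity>"
    using Rascal_wins[OF assms(1,2), of Gentle] by simp
next
  assume "odd (n * m)"
  then show "D_R (complete_graph n \<box> complete_graph m) = \<infinity>"
    using Rascal_wins[OF assms(1,2), of Rascal] by simp
next
  assume "even n" "m \<ge> n - 1"
  then show "D_R (complete_graph n \<box> complete_graph m) \<le> enat (m + 1)"
    using Gentle_wins_even[OF assms] by blast
next
  assume "odd n" "even m" "m \<ge> 2 * n - 2"
  then show "D_R (complete_graph n \<box> complete_graph m) \<le> enat (m + 1)"
    using Gentle_wins_odd[OF assms, of Rascal] by simp
next
  assume "odd n" "odd m" "m \<ge> 2 * n - 1"
  then show "D_G (complete_graph n \<box> complete_graph m) \<le> enat (m + 1)"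
    using Gentle_wins_odd[OF assms, of Gentle] by simp
qed

end
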